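(* Let $(\{A_\alpha\}_{\alpha\in\Omega},\{\Psi_\alpha\}_{\alpha\in\Omega})$ be a continuous operator-valued frame in $\mathcal{B}(\mathcal{H},\mathcal{H}_0)$ with bounds $a$ and $b$. Suppose $\{B_\alpha\}_{\alpha\in\Omega}$ is continuous Bessel (with respect to itself) in $\mathcal{B}(\mathcal{H},\mathcal{H}_0)$ such that $\theta_\Psi^*\theta_B\ge0$ and there exist real numbers $\kappa,\beta,\gamma\ge0$ with $\max\{\kappa+\frac{\gamma}{\sqrt a},\beta\}<1$ such that for all $h\in\mathcal{H}$ $$\left|\int_\Omega\langle(A_\alpha-B_\alpha)h,\Psi_\alpha h\rangle\,d\mu(\alpha)\right|^{\frac12}\le\kappa\left(\int_\Omega\langle A_\alpha h,\Psi_\alpha h\rangle\,d\mu(\alpha)\right)^{\frac12}+\beta\left(\int_\Omega\langle B_\alpha h,\Psi_\alpha h\rangle\,d\mu(\alpha)\right)^{\frac12}+\gamma\|h\|.$$ Then $(\{B_\alpha\}_{\alpha\in\Omega},\{\Psi_\alpha\}_{\alpha\in\Omega})$ is a continuous operator-valued frame with bounds $$a\left(1-\frac{\kappa+\beta+\frac{\gamma}{\sqrt a}}{1+\beta}\right)^2\quad\text{and}\quad b\left(1+\frac{\kappa+\beta+\frac{\gamma}{\sqrt b}}{1-\beta}\right)^2.$$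
   Context: $\mathcal{H},\mathcal{H}_0$ are Hilbert spaces over $\mathbb{K}\in\{\mathbb{R},\mathbb{C}\}$; $\mathcal{B}(\mathcal{H},\mathcal{H}_0)$ denotes bounded linear operators; $(\Omega,\mu)$ is a measure space with positive measure. All vector-valued integrals are weak: $\int_\Omega F\,d\mu$ is the element of $\mathcal{H}$ with $\langle\int_\Omega F\,d\mu,g\rangle=\int_\Omega\langle F(\alpha),g\rangle\,d\mu(\alpha)$ for all $g\in\mathcal{H}$. A collection $\{A_\alpha\}_{\alpha\in\Omega}$ in $\mathcal{B}(\mathcal{H},\mathcal{H}_0)$ is a continuous operator-valued frame with respect to $\{\Psi_\alpha\}_{\alpha\in\Omega}$ in $\mathcal{B}(\mathcal{H},\mathcal{H}_0)$ (one says $(\{A_\alpha\}_{\alpha\in\Omega},\{\Psi_\alpha\}_{\alpha\in\Omega})$ is a continuous operator-valued frame) if: (1) for each $h\in\mathcal{H}$ the maps $\alpha\mapsto A_\alpha h$ and $\alpha\mapsto\Psi_\alpha h$ are measurable; (2) the frame operator $S_{A,\Psi}:\mathcal{H}\ni h\mapsto\int_\Omega\Psi_\alpha^*A_\alpha h\,d\mu(\alpha)\in\mathcal{H}$ is a well-defined bounded positive invertible operator; (3) the analysis operators $\theta_A,\theta_\Psi:\mathcal{H}\to\mathcal{L}^2(\Omega,\mathcal{H}_0)$, $(\theta_Ah)(\alpha)=A_\alpha h$, $(\theta_\Psi h)(\alpha)=\Psi_\alpha h$, are well-defined bounded linear operators. If in (2) invertibility is dropped (only bounded and positive), $\{A_\alpha\}$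 is called continuous Bessel with respect to $\{\Psi_\alpha\}$; "with respect to itself" means $\Psi_\alpha=A_\alpha$ for all $\alpha$. Bounds $a,b>0$ of a frame mean $a\|h\|^2\le\langle S_{A,\Psi}h,h\rangle\le b\|h\|^2$ for all $h\in\mathcal{H}$. *)

theory Defs
  imports "HOL-Analysis.Analysis"
begin

(* The scalar field K. Every z is a root of X^2 - 2 (sre z) X + (norm z)^2, so a field of this
   class has degree at most 2 over the reals: it is the reals or the complex numbers, with the
   usual conjugation, real part and absolute value. *)
class real_or_complex = real_normed_field + banach + second_countable_topology +
  fixes sconj :: "'a \<Rightarrow> 'a"
    and sre :: "'a \<Rightarrow> real"
  assumes sconj_add: "sconj (x + y) = sconj x + sconj y"
    and sconj_mult: "sconj (x * y) = sconj x * sconj y"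
    and sconj_scaleR_1: "sconj (r *\<^sub>R 1) = r *\<^sub>R 1"
    and sconj_sconj: "sconj (sconj x) = x"
    and mult_sconj: "x * sconj x = (norm x)\<^sup>2 *\<^sub>R 1"
    and add_sconj: "x + sconj x = (2 * sre x) *\<^sub>R 1"

instantiation real :: real_or_complex
begin

definition "sconj (x :: real) = x"
definition "sre (x :: real) = x"

instance
  by standard (auto simp: sconj_real_def sre_real_def power2_eq_square)

end

instantiation complex :: real_or_complex
begin

definition "sconj (x :: complex) = cnj x"
definition "sre (x :: complex) = Re x"

instance
proof
  fix x y :: complex and r :: real
  show "sconj (x + y) = sconj x + sconj y" and "sconj (x * y) = sconj x * sconj y"
    and "sconj (r *\<^sub>R 1 :: complex) = r *\<^sub>R 1" and "sconj (sconj x) = x"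
    by (simp_all add: sconj_complex_def)
  show "x * sconj x = (norm x)\<^sup>2 *\<^sub>R 1"
    by (simp add: sconj_complex_def scaleR_conv_of_real del: of_real_power flip: complex_norm_square)
  show "x + sconj x = (2 * sre x) *\<^sub>R 1"
    by (simp add: sconj_complex_def sre_complex_def complex_eq_iff)
qed

end

(* Hilbert spaces over K. Completeness is the class constraint banach, positive definiteness is
   contained in norm_ip, and the inner product is linear in its first argument. *)
locale hilbert_space = vector_space scl
  for scl :: "'k::real_or_complex \<Rightarrow> 'h::banach \<Rightarrow> 'h" +
  fixes ip :: "'h \<Rightarrow> 'h \<Rightarrow> 'k"
  assumes scl_of_real: "scl (of_real r) x = r *\<^sub>R x"
    and ip_add_left: "ip (x + y) z = ip x z + ip y z"
    and ip_scl_left: "ip (scl c x) y = c * ip x y"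
    and ip_commute: "ip y x = sconj (ip x y)"
    and norm_ip: "ip x x = of_real ((norm x)\<^sup>2)"

definition bounded_op ::
  "('k \<Rightarrow> 'h::real_normed_vector \<Rightarrow> 'h) \<Rightarrow> ('k \<Rightarrow> 'g::real_normed_vector \<Rightarrow> 'g)
    \<Rightarrow> ('h \<Rightarrow> 'g) \<Rightarrow> bool"
  where "bounded_op scl scl0 T \<longleftrightarrow> bounded_linear T \<and> (\<forall>c x. T (scl c x) = scl0 c (T x))"

definition adjoint_op ::
  "('h \<Rightarrow> 'h \<Rightarrow> 'k) \<Rightarrow> ('g \<Rightarrow> 'g \<Rightarrow> 'k) \<Rightarrow> ('h \<Rightarrow> 'g) \<Rightarrow> 'g \<Rightarrow> 'h"
  where "adjoint_op ip ip0 T y = (THE x. \<forall>z. ip x z = ip0 y (T z))"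

(* Self-adjointness is automatic for complex scalars and is part of the usual meaning of
   positivity for real ones. *)
definition positive_op :: "('h \<Rightarrow> 'h \<Rightarrow> 'k::real_or_complex) \<Rightarrow> ('h \<Rightarrow> 'h) \<Rightarrow> bool"
  where "positive_op ip T \<longleftrightarrow>
    (\<forall>x y. ip (T x) y = ip x (T y)) \<and> (\<forall>x. \<exists>r\<ge>0. ip (T x) x = of_real r)"

definition invertible_op :: "('k \<Rightarrow> 'h::real_normed_vector \<Rightarrow> 'h) \<Rightarrow> ('h \<Rightarrow> 'h) \<Rightarrow> bool"
  where "invertible_op scl T \<longleftrightarrow> (\<exists>R. bounded_op scl scl R \<and> T \<circ> R = id \<and> R \<circ> T = id)"

definition has_weak_integral ::
  "'w measure \<Rightarrow> ('h \<Rightarrow> 'h \<Rightarrow> 'k::real_or_complex) \<Rightarrow> ('w \<Rightarrow> 'h) \<Rightarrow> 'h \<Rightarrow> bool"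
  where "has_weak_integral M ip F x \<longleftrightarrow>
    (\<forall>g. integrable M (\<lambda>\<alpha>. ip (F \<alpha>) g) \<and> ip x g = (LINT \<alpha>|M. ip (F \<alpha>) g))"

definition weak_integral ::
  "'w measure \<Rightarrow> ('h \<Rightarrow> 'h \<Rightarrow> 'k::real_or_complex) \<Rightarrow> ('w \<Rightarrow> 'h) \<Rightarrow> 'h"
  where "weak_integral M ip F = (THE x. has_weak_integral M ip F x)"

(* Measurability of Hilbert-space-valued functions, in the sense for which the square-integrable
   ones form a Hilbert space also when the target is not separable. For separable targets this is
   Borel measurability, see below. *)
definition strongly_measurable :: "'w measure \<Rightarrow> ('w \<Rightarrow> 'g::metric_space) \<Rightarrow> bool"
  where "strongly_measurable M f \<longleftrightarrow>
    (\<exists>s. (\<forall>n::nat. simple_function M (s n)) \<and> (\<forall>\<alpha>\<in>space M. (\<lambda>n. s n \<alpha>) \<longlonglongrightarrow> f \<alpha>))"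

lemma strongly_measurable_iff_borel_measurable:
  fixes f :: "'w \<Rightarrow> 'g::{metric_space, second_countable_topology}"
  shows "strongly_measurable M f \<longleftrightarrow> f \<in> borel_measurable M"
proof
  assume "strongly_measurable M f"
  then obtain s where s: "\<And>n::nat. simple_function M (s n)"
    and lim: "\<And>\<alpha>. \<alpha> \<in> space M \<Longrightarrow> (\<lambda>n. s n \<alpha>) \<longlonglongrightarrow> f \<alpha>"
    unfolding strongly_measurable_def by auto
  show "f \<in> borel_measurable M"
    by (rule borel_measurable_LIMSEQ_metric[OF borel_measurable_simple_function[OF s] lim])
next
  assume f: "f \<in> borel_measurable M"
  obtain s where "\<And>n::nat. simple_function M (s n)"
    and "\<And>\<alpha>. \<alpha> \<in> space M \<Longrightarrow> (\<lambda>n. s n \<alpha>) \<longlonglongrightarrow> f \<alpha>"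
    using borel_measurable_implies_sequence_metric[OF f, of undefined] by metis
  then show "strongly_measurable M f"
    unfolding strongly_measurable_def by (intro exI[of _ s]) simp
qed

(* Elements of L2 are represented by functions; two functions that agree almost everywhere
   represent the same element. *)
definition L2 :: "'w measure \<Rightarrow> ('w \<Rightarrow> 'g::real_normed_vector) set"
  where "L2 M = {f. strongly_measurable M f \<and> integrable M (\<lambda>\<alpha>. (norm (f \<alpha>))\<^sup>2)}"

definition L2_norm :: "'w measure \<Rightarrow> ('w \<Rightarrow> 'g::real_normed_vector) \<Rightarrow> real"
  where "L2_norm M f = sqrt (LINT \<alpha>|M. (norm (f \<alpha>))\<^sup>2)"

definition L2_ip ::
  "'w measure \<Rightarrow> ('g \<Rightarrow> 'g \<Rightarrow> 'k::real_or_complex) \<Rightarrow> ('w \<Rightarrow> 'g) \<Rightarrow> ('w \<Rightarrow> 'g) \<Rightarrow> 'k"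
  where "L2_ip M ip0 f g = (LINT \<alpha>|M. ip0 (f \<alpha>) (g \<alpha>))"

definition bounded_op_L2 ::
  "'w measure \<Rightarrow> ('k \<Rightarrow> 'h::real_normed_vector \<Rightarrow> 'h) \<Rightarrow> ('k \<Rightarrow> 'g::real_normed_vector \<Rightarrow> 'g)
    \<Rightarrow> ('h \<Rightarrow> 'w \<Rightarrow> 'g) \<Rightarrow> bool"
  where "bounded_op_L2 M scl scl0 \<theta> \<longleftrightarrow>
    (\<forall>h. \<theta> h \<in> L2 M) \<and>
    (\<forall>h k. AE \<alpha> in M. \<theta> (h + k) \<alpha> = \<theta> h \<alpha> + \<theta> k \<alpha>) \<and>
    (\<forall>c h. AE \<alpha> in M. \<theta> (scl c h) \<alpha> = scl0 c (\<theta> h \<alpha>)) \<and>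
    (\<exists>C. \<forall>h. L2_norm M (\<theta> h) \<le> C * norm h)"

definition adjoint_L2 ::
  "'w measure \<Rightarrow> ('h \<Rightarrow> 'h \<Rightarrow> 'k::real_or_complex) \<Rightarrow> ('g \<Rightarrow> 'g \<Rightarrow> 'k)
    \<Rightarrow> ('h \<Rightarrow> 'w \<Rightarrow> 'g) \<Rightarrow> ('w \<Rightarrow> 'g) \<Rightarrow> 'h"
  where "adjoint_L2 M ip ip0 \<theta> f = (THE x. \<forall>h. ip x h = L2_ip M ip0 f (\<theta> h))"

definition analysis_op :: "('w \<Rightarrow> 'h \<Rightarrow> 'g) \<Rightarrow> 'h \<Rightarrow> 'w \<Rightarrow> 'g"
  where "analysis_op A h = (\<lambda>\<alpha>. A \<alpha> h)"

definition frame_op ::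
  "'w measure \<Rightarrow> ('h \<Rightarrow> 'h \<Rightarrow> 'k::real_or_complex) \<Rightarrow> ('g \<Rightarrow> 'g \<Rightarrow> 'k)
    \<Rightarrow> ('w \<Rightarrow> 'h \<Rightarrow> 'g) \<Rightarrow> ('w \<Rightarrow> 'h \<Rightarrow> 'g) \<Rightarrow> 'h \<Rightarrow> 'h"
  where "frame_op M ip ip0 A \<Psi> h =
    weak_integral M ip (\<lambda>\<alpha>. adjoint_op ip ip0 (\<Psi> \<alpha>) (A \<alpha> h))"

(* The collections are indexed by space M; their values outside of it are irrelevant. *)
definition continuous_bessel ::
  "'w measure \<Rightarrow> ('k::real_or_complex \<Rightarrow> 'h::banach \<Rightarrow> 'h) \<Rightarrow> ('h \<Rightarrow> 'h \<Rightarrow> 'k)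
    \<Rightarrow> ('k \<Rightarrow> 'g::banach \<Rightarrow> 'g) \<Rightarrow> ('g \<Rightarrow> 'g \<Rightarrow> 'k)
    \<Rightarrow> ('w \<Rightarrow> 'h \<Rightarrow> 'g) \<Rightarrow> ('w \<Rightarrow> 'h \<Rightarrow> 'g) \<Rightarrow> bool"
  where "continuous_bessel M scl ip scl0 ip0 A \<Psi> \<longleftrightarrow>
    (\<forall>\<alpha>\<in>space M. bounded_op scl scl0 (A \<alpha>) \<and> bounded_op scl scl0 (\<Psi> \<alpha>)) \<and>
    (\<forall>h. strongly_measurable M (\<lambda>\<alpha>. A \<alpha> h) \<and> strongly_measurable M (\<lambda>\<alpha>. \<Psi> \<alpha> h)) \<and>
    (\<forall>h. \<exists>x. has_weak_integral M ip (\<lambda>\<alpha>. adjoint_op ip ip0 (\<Psi> \<alpha>) (A \<alpha> h)) x) \<and>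
    bounded_op scl scl (frame_op M ip ip0 A \<Psi>) \<and>
    positive_op ip (frame_op M ip ip0 A \<Psi>) \<and>
    bounded_op_L2 M scl scl0 (analysis_op A) \<and>
    bounded_op_L2 M scl scl0 (analysis_op \<Psi>)"

definition continuous_ovf ::
  "'w measure \<Rightarrow> ('k::real_or_complex \<Rightarrow> 'h::banach \<Rightarrow> 'h) \<Rightarrow> ('h \<Rightarrow> 'h \<Rightarrow> 'k)
    \<Rightarrow> ('k \<Rightarrow> 'g::banach \<Rightarrow> 'g) \<Rightarrow> ('g \<Rightarrow> 'g \<Rightarrow> 'k)
    \<Rightarrow> ('w \<Rightarrow> 'h \<Rightarrow> 'g) \<Rightarrow> ('w \<Rightarrow> 'h \<Rightarrow> 'g) \<Rightarrow> bool"
  where "continuous_ovf M scl ip scl0 ip0 A \<Psi> \<longleftrightarrow>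
    continuous_bessel M scl ip scl0 ip0 A \<Psi> \<and> invertible_op scl (frame_op M ip ip0 A \<Psi>)"

definition frame_bounds ::
  "'w measure \<Rightarrow> ('h::banach \<Rightarrow> 'h \<Rightarrow> 'k::real_or_complex) \<Rightarrow> ('g \<Rightarrow> 'g \<Rightarrow> 'k)
    \<Rightarrow> ('w \<Rightarrow> 'h \<Rightarrow> 'g) \<Rightarrow> ('w \<Rightarrow> 'h \<Rightarrow> 'g) \<Rightarrow> real \<Rightarrow> real \<Rightarrow> bool"
  where "frame_bounds M ip ip0 A \<Psi> a b \<longleftrightarrow> a > 0 \<and> b > 0 \<and>
    (\<forall>h. a * (norm h)\<^sup>2 \<le> sre (ip (frame_op M ip ip0 A \<Psi> h) h) \<and>
         sre (ip (frame_op M ip ip0 A \<Psi> h) h) \<le> b * (norm h)\<^sup>2)"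

end

theory Submission imports Defs
begin

text \<open>
  Put \<open>p h = \<langle>S\<^sub>A h, h\<rangle>\<close> and \<open>q h = \<langle>T h, h\<rangle>\<close>, where \<open>T = \<theta>\<^sub>\<Psi>\<^sup>* \<theta>\<^sub>B\<close> is the frame operator of
  \<open>(B, \<Psi>)\<close>. Both are real and nonnegative, and \<open>\<bar>\<surd>p - \<surd>q\<bar> \<le> \<surd>\<bar>p - q\<bar>\<close>, so the hypothesis gives
  \<open>(1 + \<beta>) \<surd>q \<ge> (1 - \<kappa>) \<surd>p - \<gamma> \<parallel>h\<parallel>\<close> and \<open>(1 - \<beta>) \<surd>q \<le> (1 + \<kappa>) \<surd>p + \<gamma> \<parallel>h\<parallel>\<close>; inserting the bounds of \<open>p\<close>
  yields those of \<open>q\<close>. The lower bound is positive, so \<open>T\<close> is coercive, hence invertible.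
\<close>

subsection \<open>The scalar field\<close>

text \<open>The class constrains \<open>sre\<close> only through \<open>add_sconj\<close>. The
  equations for \<open>sre\<close> therefore come from writing its double as a sum with the
  conjugate and cancelling the injective \<open>of_real\<close>.\<close>

lemma sre_of_real [simp]: "sre (of_real r :: 'k::real_or_complex) = r"
proof -
  have "of_real r + of_real r = (of_real (2 * sre (of_real r :: 'k)) :: 'k)"
    using add_sconj[of "of_real r :: 'k"] by (simp add: of_real_def sconj_scaleR_1)
  then have "(of_real (r + r) :: 'k) = of_real (2 * sre (of_real r :: 'k))"
    by (simp only: of_real_add)
  then show ?thesis
    by (simp only: of_real_eq_iff)
qed

lemma sconj_of_real [simp]: "sconj (of_real r :: 'k::real_or_complex) = of_real r"
  by (simp add: of_real_def sconj_scaleR_1)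

lemma add_sconj_of_real: "x + sconj x = (of_real (2 * sre x) :: 'k::real_or_complex)"
  by (simp add: of_real_def add_sconj)

lemma mult_sconj_of_real: "x * sconj x = (of_real ((norm x)\<^sup>2) :: 'k::real_or_complex)"
  by (simp add: of_real_def mult_sconj)

lemma sre_add: "sre (x + y :: 'k::real_or_complex) = sre x + sre y"
proof -
  have "(of_real (2 * sre (x + y)) :: 'k) = of_real (2 * sre x + 2 * sre y)"
    unfolding add_sconj_of_real[symmetric] of_real_add by (simp add: sconj_add)
  then show ?thesis
    by (simp only: of_real_eq_iff)
qed

lemma sre_of_real_mult: "sre (of_real r * x :: 'k::real_or_complex) = r * sre x"
proof -
  have "(of_real (2 * sre (of_real r * x)) :: 'k) = of_real (r * (2 * sre x))"
    unfolding add_sconj_of_real[symmetric] of_real_mult[of r]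
    by (simp add: sconj_mult distrib_left)
  then show ?thesis
    by (simp only: of_real_eq_iff)
qed

text \<open>Norms are multiplicative, so taking them in \<open>mult_sconj\<close> gives the claim
  after cancelling \<open>norm x\<close>.\<close>

lemma norm_sconj [simp]: "norm (sconj x :: 'k::real_or_complex) = norm x"
proof (cases "x = 0")
  case True
  then show ?thesis
    using sconj_of_real[of 0, where 'k = 'k] by simp
next
  case False
  have "norm x * norm (sconj x) = norm x * norm x"
    using arg_cong[OF mult_sconj_of_real[of x], of norm]
    by (simp add: norm_mult power2_eq_square del: of_real_mult of_real_power)
  with False show ?thesis
    by simp
qed

lemma abs_sre_le: "\<bar>sre (x :: 'k::real_or_complex)\<bar> \<le> norm x"
proof -
  have "norm (of_real (2 * sre x) :: 'k) \<le> norm x + norm (sconj x)"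
    unfolding add_sconj_of_real[symmetric] by (rule norm_triangle_ineq)
  then show ?thesis
    by (simp add: norm_mult del: of_real_mult)
qed

lemma sre_sconj [simp]: "sre (sconj x :: 'k::real_or_complex) = sre x"
proof -
  have "(of_real (2 * sre (sconj x)) :: 'k) = of_real (2 * sre x)"
    unfolding add_sconj_of_real[symmetric] by (simp add: sconj_sconj add.commute)
  then show ?thesis
    by (simp only: of_real_eq_iff)
qed

lemma bounded_linear_sre: "bounded_linear (sre :: 'k::real_or_complex \<Rightarrow> real)"
proof (rule bounded_linear_intro[where K = 1])
  show "sre (r *\<^sub>R x) = r *\<^sub>R sre x" for r and x :: 'k
    by (simp add: scaleR_conv_of_real sre_of_real_mult)
qed (auto simp: sre_add abs_sre_le)

text \<open>A nonnegative polynomial in \<open>t\<close> that vanishes at 0 has derivative zero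
  there. In \<open>riesz_real\<close> this turns minimality into the representing identity.\<close>

lemma quadratic_nonneg_imp_zero:
  fixes d N :: real
  assumes N: "N \<ge> 0" and ge: "\<And>t. t\<^sup>2 * N + 2 * t * d \<ge> 0"
  shows "d = 0"
proof (rule ccontr)
  assume d: "d \<noteq> 0"
  \<comment> \<open>The minimiser is \<open>- d / N\<close>; the added 1 covers \<open>N = 0\<close>
    and still gives a negative value.\<close>
  let ?t = "- d / (N + 1)"
  have "0 \<le> (?t\<^sup>2 * N + 2 * ?t * d) * (N + 1)\<^sup>2"
    using ge[of ?t] by (intro mult_nonneg_nonneg) auto
  also have "\<dots> = - (d\<^sup>2 * (N + 2))"
    using N by (simp add: divide_simps power2_eq_square) (simp add: algebra_simps)
  also have "\<dots> < 0"
    using d N by simp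
  finally show False by simp
qed

subsection \<open>Riesz representation and coercive operators\<close>

context hilbert_space
begin

section \<open>Inner product identities and the Cauchy-Schwarz inequality\<close>

lemma ip_add_right: "ip x (y + z) = ip x y + ip x z"
  using ip_commute sconj_add ip_add_left by metis

lemma ip_scl_right: "ip x (scl c y) = sconj c * ip x y"
  using ip_commute sconj_mult ip_scl_left by metis

lemma ip_scaleR_left: "ip (r *\<^sub>R x) y = r *\<^sub>R ip x y"
  unfolding scl_of_real[symmetric] by (simp add: ip_scl_left scaleR_conv_of_real)

lemma ip_scaleR_right: "ip x (r *\<^sub>R y) = r *\<^sub>R ip x y"
  unfolding scl_of_real[symmetric] by (simp add: ip_scl_right scaleR_conv_of_real)

lemma sre_ip_commute: "sre (ip x y) = sre (ip y x)"
  by (subst ip_commute) simp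

text \<open>The one expansion behind Cauchy-Schwarz, the parallelogram law, the minimality argument
  and the contraction estimate.\<close>

lemma norm_add_scaleR_sq:
  "(norm (x + t *\<^sub>R y))\<^sup>2 = (norm x)\<^sup>2 + 2 * t * sre (ip x y) + t\<^sup>2 * (norm y)\<^sup>2"
proof -
  have "(norm (x + t *\<^sub>R y))\<^sup>2 = sre (ip (x + t *\<^sub>R y) (x + t *\<^sub>R y))"
    by (simp add: norm_ip del: of_real_power)
  also have "\<dots> = sre (ip x x) + t * sre (ip x y) + t * sre (ip y x) + t * (t * sre (ip y y))"
    by (simp add: ip_add_left ip_add_right ip_scaleR_left ip_scaleR_right sre_add
        scaleR_conv_of_real sre_of_real_mult distrib_left)
  finally show ?thesis
    using sre_ip_commute[of y x]
    by (simp add: norm_ip power2_eq_square algebra_simps del: of_real_power of_real_mult)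
qed

text \<open>The locale identifies \<open>scl\<close> with scaling only for real scalars; for the
  others the inner product and \<open>mult_sconj\<close> give homogeneity of the norm.\<close>

lemma norm_scl: "norm (scl c x) = norm c * norm x"
proof -
  have "ip (scl c x) (scl c x) = (c * sconj c) * ip x x"
    by (simp add: ip_scl_left ip_scl_right mult.assoc)
  then have "(of_real ((norm (scl c x))\<^sup>2) :: 'k) = of_real ((norm c * norm x)\<^sup>2)"
    unfolding norm_ip mult_sconj_of_real by (simp add: power_mult_distrib)
  then have "(norm (scl c x))\<^sup>2 = (norm c * norm x)\<^sup>2"
    by (simp only: of_real_eq_iff)
  then show ?thesis
    by simp
qed

lemma sre_ip_le: "sre (ip x y) \<le> norm x * norm y"
proof (cases "y = 0")
  case True
  then show ?thesis
    using ip_scaleR_right[of x 0 y] sre_of_real[of 0, where 'k = 'k] by simp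
next
  case False
  \<comment> \<open>Rescales \<open>y\<close> to the length of \<open>x\<close>; with equal lengths
    the expansion has the common factor \<open>2 * norm x\<close>.\<close>
  let ?t = "- norm x / norm y"
  have "0 \<le> (norm (x + ?t *\<^sub>R y))\<^sup>2"
    by simp
  also have "\<dots> = 2 * norm x * (norm x - sre (ip x y) / norm y)"
    unfolding norm_add_scaleR_sq using False
    by (simp add: field_simps power2_eq_square)
  finally have "norm x = 0 \<or> sre (ip x y) / norm y \<le> norm x"
    by (auto simp: zero_le_mult_iff)
  then show ?thesis
  proof
    assume "norm x = 0"
    then show ?thesis
      using ip_scaleR_left[of 0 x y] sre_of_real[of 0, where 'k = 'k] by simp
  next
    assume "sre (ip x y) / norm y \<le> norm x"
    then show ?thesis
      using False by (simp add: field_simps)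
  qed
qed

text \<open>Multiplying \<open>x\<close> by the conjugate of \<open>ip x y\<close> makes the inner
  product the real number \<open>(norm (ip x y))^2\<close>, so the bound for real parts
  applies.\<close>

lemma norm_ip_le: "norm (ip x y) \<le> norm x * norm y"
proof (cases "ip x y = 0")
  case False
  let ?w = "ip x y"
  have "(norm ?w)\<^sup>2 = sre (ip (scl (sconj ?w) x) y)"
    by (simp add: ip_scl_left mult.commute[of "sconj ?w"] mult_sconj_of_real del: of_real_power)
  also have "\<dots> \<le> norm ?w * (norm x * norm y)"
    using sre_ip_le[of "scl (sconj ?w) x" y] by (simp add: norm_scl mult.assoc)
  finally show ?thesis
    using False by (simp add: power2_eq_square)
qed simp

lemma bounded_bilinear_ip: "bounded_bilinear ip"
  by standard (auto simp: ip_add_left ip_add_right ip_scaleR_left ip_scaleR_right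
      intro!: exI[of _ 1] norm_ip_le)

text \<open>Supplies the uniqueness behind the \<open>THE\<close> descriptions of adjoints and weak
  integrals, and proves operator identities by testing against vectors.\<close>

lemma ip_ext:
  assumes "\<And>z. ip x z = ip y z"
  shows "x = y"
proof -
  interpret bounded_bilinear ip by (rule bounded_bilinear_ip)
  have "(of_real ((norm (x - y))\<^sup>2) :: 'k) = of_real 0"
    unfolding norm_ip[symmetric] by (simp add: diff_left assms)
  then show ?thesis
    by (simp only: of_real_eq_iff) simp
qed

text \<open>The representing vector minimises \<open>\<lambda>x. (norm x)\<^sup>2 - 2 * \<phi> x\<close>; minimising
  sequences are Cauchy by the parallelogram law.\<close>

lemma riesz_real:
  fixes \<phi> :: "'h \<Rightarrow> real"
  assumes "bounded_linear \<phi>"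
  obtains x where "\<And>z. sre (ip x z) = \<phi> z"
proof -
  interpret \<phi>: bounded_linear \<phi> by fact
  define J where "J x = (norm x)\<^sup>2 - 2 * \<phi> x" for x
  define m where "m = Inf (range J)"
  obtain C where C: "\<And>x. \<bar>\<phi> x\<bar> \<le> norm x * C"
    using \<phi>.bounded by auto
  \<comment> \<open>Completing the square: \<open>J x\<close> is at least
    \<open>(norm x - C)^2 - C^2\<close>.\<close>
  have "- C\<^sup>2 \<le> J x" for x
    using C[of x] zero_le_power2[of "norm x - C"]
    by (auto simp: J_def power2_eq_square algebra_simps)
  then have "bdd_below (range J)"
    by (auto intro!: bdd_belowI)
  then have m: "m \<le> J x" for x
    unfolding m_def by (rule cINF_lower) simp
  have "\<exists>x. J x < m + inverse (real (Suc n))" for n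
    using cInf_lessD[of "range J" "m + inverse (real (Suc n))"] by (auto simp: m_def)
  then obtain s where s: "\<And>n. J (s n) < m + inverse (real (Suc n))"
    by metis
  have half: "J ((1/2) *\<^sub>R (x + y)) = (norm (x + y))\<^sup>2 / 4 - \<phi> x - \<phi> y" for x y
    by (simp add: J_def \<phi>.add \<phi>.scaleR power_divide add_divide_distrib del: scaleR_add_right)
  \<comment> \<open>The linear terms cancel. As \<open>J\<close> is at least \<open>m\<close> at the
    midpoint, the distance is controlled by the excess of \<open>J x\<close> and \<open>J y\<close>
    over \<open>m\<close>.\<close>
  have para: "(norm (x - y))\<^sup>2 = 2 * J x + 2 * J y - 4 * J ((1/2) *\<^sub>R (x + y))" for x y
    unfolding half using norm_add_scaleR_sq[of x "-1" y] norm_add_scaleR_sq[of x 1 y]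
    by (simp add: J_def add_divide_distrib)
  have "Cauchy s"
  proof (rule metric_CauchyI)
    fix e :: real
    assume "e > 0"
    \<comment> \<open>Each of the two excesses enters \<open>para\<close> doubled, hence the
      quarter.\<close>
    then obtain N where N: "inverse (real (Suc N)) < e\<^sup>2 / 4"
      using reals_Archimedean[of "e\<^sup>2 / 4"] by auto
    have "dist (s i) (s j) < e" if "i \<ge> N" "j \<ge> N" for i j
    proof -
      have "inverse (real (Suc i)) \<le> inverse (real (Suc N))"
        "inverse (real (Suc j)) \<le> inverse (real (Suc N))"
        using that by (auto intro!: le_imp_inverse_le)
      then have "(norm (s i - s j))\<^sup>2 < e\<^sup>2"
        unfolding para using s[of i] s[of j] m[of "(1/2) *\<^sub>R (s i + s j)"] N by linarith
      then show ?thesis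
        using \<open>e > 0\<close> by (simp add: dist_norm power_less_imp_less_base)
    qed
    then show "\<exists>N. \<forall>i\<ge>N. \<forall>j\<ge>N. dist (s i) (s j) < e"
      by blast
  qed
  then obtain x where x: "s \<longlonglongrightarrow> x"
    using Cauchy_convergent convergent_def by blast
  have "(\<lambda>n. J (s n)) \<longlonglongrightarrow> J x"
    unfolding J_def by (intro tendsto_intros \<phi>.tendsto x)
  moreover have "(\<lambda>n. m + inverse (real (Suc n))) \<longlonglongrightarrow> m + 0"
    by (intro tendsto_intros LIMSEQ_inverse_real_of_nat)
  ultimately have Jx: "J x \<le> m"
    using LIMSEQ_le[of "\<lambda>n. J (s n)" "J x" "\<lambda>n. m + inverse (real (Suc n))"] s
    by (auto intro: less_imp_le)
  \<comment> \<open>The quadratic in \<open>t\<close> is \<open>J (x + t *\<^sub>R z) - J x\<close>,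
    nonnegative because \<open>x\<close> attains the infimum.\<close>
  have "sre (ip x z) - \<phi> z = 0" for z
  proof (rule quadratic_nonneg_imp_zero[where N = "(norm z)\<^sup>2"])
    show "t\<^sup>2 * (norm z)\<^sup>2 + 2 * t * (sre (ip x z) - \<phi> z) \<ge> 0" for t
      using Jx m[of "x + t *\<^sub>R z"] unfolding J_def norm_add_scaleR_sq
      by (simp add: \<phi>.add \<phi>.scaleR algebra_simps)
  qed simp
  then show ?thesis
    using that[of x] by simp
qed

text \<open>Real parts determine such a functional: if \<open>w\<close> is the defect at
  \<open>z\<close>, equality of real parts at \<open>scl w z\<close> gives
  \<open>(norm w)^2 = 0\<close>. The conjugate in \<open>F_scl\<close> reflects that
  \<open>ip\<close> is conjugate-linear in its second argument.\<close>

lemma riesz: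
  fixes F :: "'h \<Rightarrow> 'k"
  assumes F: "bounded_linear F" and F_scl: "\<And>c z. F (scl c z) = sconj c * F z"
  obtains x where "\<And>z. ip x z = F z"
proof -
  have "bounded_linear (\<lambda>z. sre (F z))"
    by (rule bounded_linear_compose[OF bounded_linear_sre F])
  then obtain x where x: "\<And>z. sre (ip x z) = sre (F z)"
    using riesz_real by metis
  interpret sre: bounded_linear "sre :: 'k \<Rightarrow> real" by (rule bounded_linear_sre)
  have "ip x z = F z" for z
  proof -
    define w where "w = ip x z - F z"
    have "(norm w)\<^sup>2 = sre (sconj w * w)"
      by (simp add: mult.commute[of "sconj w"] mult_sconj_of_real del: of_real_power)
    also have "\<dots> = sre (ip x (scl w z)) - sre (F (scl w z))"
      by (simp add: w_def ip_scl_right F_scl right_diff_distrib sre.diff)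
    finally show ?thesis
      by (simp add: x w_def)
  qed
  then show ?thesis
    using that by blast
qed

text \<open>For small \<open>\<rho> > 0\<close> the map \<open>\<lambda>x. x - \<rho> *\<^sub>R (T x - y)\<close> is a contraction, whose
  fixed point solves \<open>T x = y\<close>.\<close>

lemma coercive_imp_invertible:
  assumes T: "bounded_op scl scl T" and c: "c > 0"
    and coercive: "\<And>x. c * (norm x)\<^sup>2 \<le> sre (ip (T x) x)"
  shows "invertible_op scl T"
proof -
  have bl: "bounded_linear T" and T_scl: "\<And>k x. T (scl k x) = scl k (T x)"
    using T by (auto simp: bounded_op_def)
  interpret T: bounded_linear T by fact
  have lower: "c * norm x \<le> norm (T x)" for x
  proof (cases "x = 0")
    case False
    have "c * norm x * norm x \<le> norm (T x) * norm x"
      using coercive[of x] sre_ip_le[of "T x" x] by (simp add: power2_eq_square mult.assoc)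
    then show ?thesis
      using False by simp
  qed simp
  have inj: "x = y" if "T x = T y" for x y
    using lower[of "x - y"] that c by (simp add: T.diff mult_le_0_iff)
  obtain K where K: "K > 0" "\<And>x. norm (T x) \<le> norm x * K"
    using T.pos_bounded by auto
  \<comment> \<open>The maximum guarantees \<open>c \<le> L\<close>, hence \<open>q \<ge> 0\<close>,
    even on the zero space, where \<open>K\<close> may be smaller than \<open>c\<close>.\<close>
  define L where "L = max K c"
  have L: "L > 0" "c \<le> L" "norm (T x) \<le> L * norm x" for x
    using K(1) c order_trans[OF K(2)[of x] mult_left_mono[of K L "norm x"]]
    by (auto simp: L_def mult.commute)
  \<comment> \<open>This \<rho> minimises \<open>1 - 2 * \<rho> * c + \<rho>^2 * L^2\<close>; the
    minimum is \<open>q\<close>.\<close>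
  define \<rho> where "\<rho> = c / L\<^sup>2"
  have \<rho>: "\<rho> > 0" "\<rho> * c = c\<^sup>2 / L\<^sup>2" "\<rho>\<^sup>2 * L\<^sup>2 = c\<^sup>2 / L\<^sup>2"
    using L(1) c by (simp_all add: \<rho>_def power2_eq_square)
  define q where "q = 1 - c\<^sup>2 / L\<^sup>2"
  have q: "0 \<le> q" "q < 1"
    using L(1,2) c by (auto simp: q_def power_mono)
  have contr: "norm (x - \<rho> *\<^sub>R T x) \<le> sqrt q * norm x" for x
  proof -
    have "(norm (x - \<rho> *\<^sub>R T x))\<^sup>2
        = (norm x)\<^sup>2 - 2 * \<rho> * sre (ip (T x) x) + \<rho>\<^sup>2 * (norm (T x))\<^sup>2"
      using norm_add_scaleR_sq[of x "- \<rho>" "T x"] sre_ip_commute[of x "T x"] by simp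
    also have "\<dots> \<le> (norm x)\<^sup>2 - 2 * \<rho> * (c * (norm x)\<^sup>2) + \<rho>\<^sup>2 * (L * norm x)\<^sup>2"
      using \<rho>(1) L(1) by (intro add_mono diff_mono mult_left_mono power_mono coercive L(3)) auto
    also have "\<dots> = (1 - 2 * (\<rho> * c) + \<rho>\<^sup>2 * L\<^sup>2) * (norm x)\<^sup>2"
      by (simp add: power_mult_distrib algebra_simps)
    also have "\<dots> = (sqrt q * norm x)\<^sup>2"
      unfolding \<rho>(2,3) using q(1) by (simp add: power_mult_distrib q_def)
    finally show ?thesis
      by (rule power2_le_imp_le) (simp add: q)
  qed
  have "\<exists>x. T x = y" for y
  proof -
    have "\<exists>!x. x - \<rho> *\<^sub>R (T x - y) = x"
    proof (rule banach_fix_type)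
      show "0 \<le> sqrt q" "sqrt q < 1"
        using q by auto
      show "\<forall>x z. dist (x - \<rho> *\<^sub>R (T x - y)) (z - \<rho> *\<^sub>R (T z - y)) \<le> sqrt q * dist x z"
      proof (intro allI)
        show "dist (x - \<rho> *\<^sub>R (T x - y)) (z - \<rho> *\<^sub>R (T z - y)) \<le> sqrt q * dist x z" for x z
          using contr[of "x - z"] by (simp add: dist_norm T.diff algebra_simps)
      qed
    qed
    then show ?thesis
      using \<rho>(1) by auto
  qed
  then obtain R where R: "\<And>y. T (R y) = y"
    by metis
  \<comment> \<open>Linearity of the right inverse is checked after applying the injective
    \<open>T\<close>; its bound is the lower bound of \<open>T\<close>.\<close>
  have "bounded_linear R"
  proof (rule bounded_linear_intro)
    show "R (x + y) = R x + R y" for x y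
      by (rule inj) (simp add: R T.add)
    show "R (r *\<^sub>R x) = r *\<^sub>R R x" for r x
      by (rule inj) (simp add: R T.scaleR)
    show "norm (R x) \<le> norm x * (1 / c)" for x
      using lower[of "R x"] c by (simp add: R field_simps)
  qed
  moreover have "R (scl k x) = scl k (R x)" for k x
    by (rule inj) (simp add: R T_scl)
  ultimately have "bounded_op scl scl R"
    by (simp add: bounded_op_def)
  moreover have "T \<circ> R = id" "R \<circ> T = id"
    by (auto simp: R fun_eq_iff intro: inj)
  ultimately show ?thesis
    unfolding invertible_op_def by blast
qed

subsection \<open>Weak integrals and square-integrable functions\<close>

lemma weak_integral_eq:
  assumes "has_weak_integral M ip F x"
  shows "weak_integral M ip F = x"
  unfolding weak_integral_def using assms
  by (intro the_equality ip_ext) (auto simp: has_weak_integral_def)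

text \<open>The space may be non-separable, so the simple approximants are paired first; the limit
  is then taken in the scalar field.\<close>

lemma borel_measurable_ip:
  assumes "strongly_measurable M f" "strongly_measurable M g"
  shows "(\<lambda>\<alpha>. ip (f \<alpha>) (g \<alpha>)) \<in> borel_measurable M"
proof -
  interpret bounded_bilinear ip by (rule bounded_bilinear_ip)
  obtain s where s: "\<And>n::nat. simple_function M (s n)"
    "\<And>\<alpha>. \<alpha> \<in> space M \<Longrightarrow> (\<lambda>n. s n \<alpha>) \<longlonglongrightarrow> f \<alpha>"
    using assms(1) unfolding strongly_measurable_def by auto
  obtain t where t: "\<And>n::nat. simple_function M (t n)"
    "\<And>\<alpha>. \<alpha> \<in> space M \<Longrightarrow> (\<lambda>n. t n \<alpha>) \<longlonglongrightarrow> g \<alpha>"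
    using assms(2) unfolding strongly_measurable_def by auto
  show ?thesis
  proof (rule borel_measurable_LIMSEQ_metric)
    show "(\<lambda>\<alpha>. ip (s n \<alpha>) (t n \<alpha>)) \<in> borel_measurable M" for n
      by (intro borel_measurable_simple_function simple_function_compose2[of M _ _ ip] s t)
    show "(\<lambda>n. ip (s n \<alpha>) (t n \<alpha>)) \<longlonglongrightarrow> ip (f \<alpha>) (g \<alpha>)" if "\<alpha> \<in> space M" for \<alpha>
      by (intro tendsto s t that)
  qed
qed

text \<open>Young's inequality with a free weight \<open>t\<close> bounds the integrand. The weight
  1 gives integrability, and a nearly optimal weight gives the Cauchy-Schwarz bound.\<close>

lemma
  assumes "f \<in> L2 M" "g \<in> L2 M"
  shows integrable_ip_L2: "integrable M (\<lambda>\<alpha>. ip (f \<alpha>) (g \<alpha>))"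
    and norm_L2_ip_le: "norm (L2_ip M ip f g) \<le> L2_norm M f * L2_norm M g"
proof -
  have int: "integrable M (\<lambda>\<alpha>. (norm (f \<alpha>))\<^sup>2)" "integrable M (\<lambda>\<alpha>. (norm (g \<alpha>))\<^sup>2)"
    using assms by (auto simp: L2_def)
  have le: "norm (ip (f \<alpha>) (g \<alpha>)) \<le> t / 2 * (norm (f \<alpha>))\<^sup>2 + 1 / (2 * t) * (norm (g \<alpha>))\<^sup>2"
    if "t > 0" for t \<alpha>
  proof -
    have "0 \<le> t / 2 * (norm (f \<alpha>) - norm (g \<alpha>) / t)\<^sup>2"
      using that by simp
    also have "\<dots> = t / 2 * (norm (f \<alpha>))\<^sup>2 + 1 / (2 * t) * (norm (g \<alpha>))\<^sup>2 - norm (f \<alpha>) * norm (g \<alpha>)"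
      using that by (simp add: field_simps power2_eq_square)
    finally show ?thesis
      using norm_ip_le[of "f \<alpha>" "g \<alpha>"] by linarith
  qed
  have int': "integrable M (\<lambda>\<alpha>. t / 2 * (norm (f \<alpha>))\<^sup>2 + 1 / (2 * t) * (norm (g \<alpha>))\<^sup>2)" for t
    using int by (intro Bochner_Integration.integrable_add integrable_mult_right)
  show *: "integrable M (\<lambda>\<alpha>. ip (f \<alpha>) (g \<alpha>))"
  proof (rule Bochner_Integration.integrable_bound[OF int'[of 1]])
    show "(\<lambda>\<alpha>. ip (f \<alpha>) (g \<alpha>)) \<in> borel_measurable M"
      using assms by (intro borel_measurable_ip) (auto simp: L2_def)
  qed (use le[of 1] in auto)
  define F where "F = L2_norm M f"
  define G where "G = L2_norm M g"
  have FG: "F \<ge> 0" "G \<ge> 0" "(LINT \<alpha>|M. (norm (f \<alpha>))\<^sup>2) = F\<^sup>2" "(LINT \<alpha>|M. (norm (g \<alpha>))\<^sup>2) = G\<^sup>2"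
    by (simp_all add: F_def G_def L2_norm_def integral_nonneg_AE)
  have L2_le: "norm (L2_ip M ip f g) \<le> t / 2 * F\<^sup>2 + 1 / (2 * t) * G\<^sup>2" if "t > 0" for t
  proof -
    have "norm (L2_ip M ip f g) \<le> (LINT \<alpha>|M. norm (ip (f \<alpha>) (g \<alpha>)))"
      unfolding L2_ip_def by (rule integral_norm_bound)
    also have "\<dots> \<le> (LINT \<alpha>|M. t / 2 * (norm (f \<alpha>))\<^sup>2 + 1 / (2 * t) * (norm (g \<alpha>))\<^sup>2)"
      using * le[OF that] by (intro integral_mono integrable_norm int') auto
    also have "\<dots> = t / 2 * F\<^sup>2 + 1 / (2 * t) * G\<^sup>2"
      using int FG
      by (subst Bochner_Integration.integral_add) (auto intro!: integrable_mult_right integrable_divide)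
    finally show ?thesis .
  qed
  \<comment> \<open>the optimal \<open>t = G / F\<close>, shifted by \<open>e\<close> to allow \<open>F = 0\<close> or \<open>G = 0\<close>\<close>
  have L2_le': "norm (L2_ip M ip f g) \<le> F * G + e * (F + G) / 2" if "e > 0" for e
  proof -
    have quot: "x\<^sup>2 / (x + e) \<le> x" if "x \<ge> 0" for x
      using that \<open>e > 0\<close> by (simp add: divide_simps power2_eq_square distrib_left)
    have "norm (L2_ip M ip f g) \<le> (G + e) / (F + e) / 2 * F\<^sup>2 + 1 / (2 * ((G + e) / (F + e))) * G\<^sup>2"
      using L2_le[of "(G + e) / (F + e)"] FG that by simp
    also have "\<dots> = (G + e) / 2 * (F\<^sup>2 / (F + e)) + (F + e) / 2 * (G\<^sup>2 / (G + e))"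
      by simp
    also have "\<dots> \<le> (G + e) / 2 * F + (F + e) / 2 * G"
      using FG that by (intro add_mono mult_left_mono quot) auto
    finally show ?thesis
      by (simp add: field_simps)
  qed
  have "norm (L2_ip M ip f g) \<le> F * G"
  proof (rule field_le_epsilon)
    fix e :: real
    assume "e > 0"
    \<comment> \<open>This shift keeps the error term below \<open>e\<close>; the 1 in the
      denominator covers \<open>F + G = 0\<close>.\<close>
    have "e / (F + G + 1) * (F + G) / 2 \<le> e"
      using FG \<open>e > 0\<close> by (simp add: divide_simps)
    then show "norm (L2_ip M ip f g) \<le> F * G + e"
      using L2_le'[of "e / (F + G + 1)"] FG \<open>e > 0\<close> by simp
  qed
  then show "norm (L2_ip M ip f g) \<le> L2_norm M f * L2_norm M g"
    by (simp add: F_def G_def)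
qed

end

section \<open>Adjoints and the frame operator as a composition of analysis operators\<close>

locale hilbert_space_pair = H: hilbert_space scl ip + G: hilbert_space scl0 ip0
  for scl :: "'k::real_or_complex \<Rightarrow> 'h::banach \<Rightarrow> 'h"
    and ip :: "'h \<Rightarrow> 'h \<Rightarrow> 'k"
    and scl0 :: "'k \<Rightarrow> 'g::banach \<Rightarrow> 'g"
    and ip0 :: "'g \<Rightarrow> 'g \<Rightarrow> 'k"
begin

text \<open>Riesz representation gives existence of the vector described by
  \<open>adjoint_op\<close>, and \<open>ip_ext\<close> its uniqueness.\<close>

lemma ip_adjoint_op:
  assumes "bounded_op scl scl0 T"
  shows "ip (adjoint_op ip ip0 T y) z = ip0 y (T z)"
proof -
  have T: "bounded_linear T" and T_scl: "\<And>c x. T (scl c x) = scl0 c (T x)"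
    using assms by (auto simp: bounded_op_def)
  have "bounded_linear (\<lambda>z. ip0 y (T z))"
    by (rule bounded_linear_compose[OF _ T])
      (rule bounded_bilinear.bounded_linear_right[OF G.bounded_bilinear_ip])
  then obtain x where x: "\<And>z. ip x z = ip0 y (T z)"
    by (rule H.riesz[where F = "\<lambda>z. ip0 y (T z)"]) (auto simp: T_scl G.ip_scl_right)
  then have "adjoint_op ip ip0 T y = x"
    unfolding adjoint_op_def by (intro the_equality H.ip_ext) auto
  then show ?thesis
    by (simp add: x)
qed

text \<open>\<open>bounded_op_L2\<close> gives linearity only almost everywhere, so the identities
  go through \<open>integral_cong_AE\<close>, with measurability taken from the integrability of the
  pairings.\<close>

lemma
  assumes "bounded_op_L2 M scl scl0 \<theta>" "f \<in> L2 M"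
  shows L2_ip_add_right: "L2_ip M ip0 f (\<theta> (h + k)) = L2_ip M ip0 f (\<theta> h) + L2_ip M ip0 f (\<theta> k)"
    and L2_ip_scl_right: "L2_ip M ip0 f (\<theta> (scl c h)) = sconj c * L2_ip M ip0 f (\<theta> h)"
    and L2_ip_add_left: "L2_ip M ip0 (\<theta> (h + k)) f = L2_ip M ip0 (\<theta> h) f + L2_ip M ip0 (\<theta> k) f"
    and L2_ip_scl_left: "L2_ip M ip0 (\<theta> (scl c h)) f = c * L2_ip M ip0 (\<theta> h) f"
proof -
  have \<theta>: "\<theta> h \<in> L2 M" and add: "AE \<alpha> in M. \<theta> (h + k) \<alpha> = \<theta> h \<alpha> + \<theta> k \<alpha>"
    and scl: "AE \<alpha> in M. \<theta> (scl c h) \<alpha> = scl0 c (\<theta> h \<alpha>)" for h k c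
    using assms(1) by (auto simp: bounded_op_L2_def)
  note int = G.integrable_ip_L2[OF \<theta> assms(2)] G.integrable_ip_L2[OF assms(2) \<theta>]
  note meas = borel_measurable_integrable[OF int(1)] borel_measurable_integrable[OF int(2)]
  show "L2_ip M ip0 f (\<theta> (h + k)) = L2_ip M ip0 f (\<theta> h) + L2_ip M ip0 f (\<theta> k)"
    unfolding L2_ip_def Bochner_Integration.integral_add[OF int(2) int(2), symmetric]
    using add[of h k] by (intro integral_cong_AE borel_measurable_add meas) (auto simp: G.ip_add_right)
  show "L2_ip M ip0 (\<theta> (h + k)) f = L2_ip M ip0 (\<theta> h) f + L2_ip M ip0 (\<theta> k) f"
    unfolding L2_ip_def Bochner_Integration.integral_add[OF int(1) int(1), symmetric]
    using add[of h k] by (intro integral_cong_AE borel_measurable_add meas) (auto simp: G.ip_add_left)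
  show "L2_ip M ip0 f (\<theta> (scl c h)) = sconj c * L2_ip M ip0 f (\<theta> h)"
    unfolding L2_ip_def integral_mult_right_zero[symmetric]
    using scl[of c h] by (intro integral_cong_AE borel_measurable_times borel_measurable_const meas)
      (auto simp: G.ip_scl_right)
  show "L2_ip M ip0 (\<theta> (scl c h)) f = c * L2_ip M ip0 (\<theta> h) f"
    unfolding L2_ip_def integral_mult_right_zero[symmetric]
    using scl[of c h] by (intro integral_cong_AE borel_measurable_times borel_measurable_const meas)
      (auto simp: G.ip_scl_left)
qed

text \<open>Cauchy-Schwarz in L2 and the bound on \<theta> make the pairing with \<open>f\<close> a
  bounded conjugate-linear functional on the domain, so Riesz applies there.\<close>

lemma ip_adjoint_L2:
  assumes \<theta>: "bounded_op_L2 M scl scl0 \<theta>" and f: "f \<in> L2 M"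
  shows "ip (adjoint_L2 M ip ip0 \<theta> f) h = L2_ip M ip0 f (\<theta> h)"
proof -
  obtain C where C: "\<And>h. L2_norm M (\<theta> h) \<le> C * norm h"
    using \<theta> by (auto simp: bounded_op_L2_def)
  have "bounded_linear (\<lambda>h. L2_ip M ip0 f (\<theta> h))"
  proof (rule bounded_linear_intro)
    show "L2_ip M ip0 f (\<theta> (h + k)) = L2_ip M ip0 f (\<theta> h) + L2_ip M ip0 f (\<theta> k)" for h k
      by (rule L2_ip_add_right[OF \<theta> f])
    show "L2_ip M ip0 f (\<theta> (r *\<^sub>R h)) = r *\<^sub>R L2_ip M ip0 f (\<theta> h)" for r h
      using L2_ip_scl_right[OF \<theta> f, of "of_real r" h]
      by (simp add: H.scl_of_real scaleR_conv_of_real)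
    show "norm (L2_ip M ip0 f (\<theta> h)) \<le> norm h * (L2_norm M f * C)" for h
    proof -
      have "norm (L2_ip M ip0 f (\<theta> h)) \<le> L2_norm M f * L2_norm M (\<theta> h)"
        using \<theta> f by (intro G.norm_L2_ip_le) (auto simp: bounded_op_L2_def)
      also have "\<dots> \<le> L2_norm M f * (C * norm h)"
        by (intro mult_left_mono C) (simp add: L2_norm_def integral_nonneg_AE)
      finally show ?thesis
        by (simp add: mult.commute mult.left_commute)
    qed
  qed
  then obtain x where x: "\<And>h. ip x h = L2_ip M ip0 f (\<theta> h)"
    by (rule H.riesz[where F = "\<lambda>h. L2_ip M ip0 f (\<theta> h)"]) (auto simp: L2_ip_scl_right[OF \<theta> f])
  then have "adjoint_L2 M ip ip0 \<theta> f = x"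
    unfolding adjoint_L2_def by (intro the_equality H.ip_ext) auto
  then show ?thesis
    by (simp add: x)
qed

text \<open>The composition is determined by the L2 pairing of \<open>\<theta> h\<close> with
  \<open>\<phi> g\<close>. Testing gives linearity; choosing \<open>g = S h\<close> and cancelling
  \<open>norm (S h)\<close> gives the bound.\<close>

lemma bounded_op_adjoint_L2_comp:
  assumes \<phi>: "bounded_op_L2 M scl scl0 \<phi>" and \<theta>: "bounded_op_L2 M scl scl0 \<theta>"
  shows "bounded_op scl scl (adjoint_L2 M ip ip0 \<phi> \<circ> \<theta>)"
proof -
  define S where "S = adjoint_L2 M ip ip0 \<phi> \<circ> \<theta>"
  have L2: "\<theta> h \<in> L2 M" "\<phi> h \<in> L2 M" for h
    using \<theta> \<phi> by (auto simp: bounded_op_L2_def)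
  have S: "ip (S h) g = L2_ip M ip0 (\<theta> h) (\<phi> g)" for h g
    unfolding S_def comp_def by (rule ip_adjoint_L2[OF \<phi> L2(1)])
  obtain C where C: "\<And>h. L2_norm M (\<theta> h) \<le> C * norm h"
    using \<theta> by (auto simp: bounded_op_L2_def)
  obtain D where D: "\<And>h. L2_norm M (\<phi> h) \<le> D * norm h"
    using \<phi> by (auto simp: bounded_op_L2_def)
  have L2_norm_nonneg: "L2_norm M f \<ge> 0" for f :: "_ \<Rightarrow> 'g"
    by (simp add: L2_norm_def integral_nonneg_AE)
  have S_scl: "S (scl c h) = scl c (S h)" for c h
    by (rule H.ip_ext) (simp add: S H.ip_scl_left L2_ip_scl_left[OF \<theta> L2(2)])
  have "bounded_linear S"
  proof (rule bounded_linear_intro)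
    show "S (h + k) = S h + S k" for h k
      by (rule H.ip_ext) (simp add: S H.ip_add_left L2_ip_add_left[OF \<theta> L2(2)])
    show "S (r *\<^sub>R h) = r *\<^sub>R S h" for r h
      using S_scl[of "of_real r" h] by (simp add: H.scl_of_real)
    show "norm (S h) \<le> norm h * (C * D)" for h
    proof (cases "S h = 0")
      case False
      have "(norm (S h))\<^sup>2 = norm (ip (S h) (S h))"
        by (simp add: H.norm_ip norm_power)
      also have "\<dots> \<le> L2_norm M (\<theta> h) * L2_norm M (\<phi> (S h))"
        unfolding S by (intro G.norm_L2_ip_le L2)
      also have "\<dots> \<le> (C * norm h) * (D * norm (S h))"
        using C D by (intro mult_mono L2_norm_nonneg order_trans[OF L2_norm_nonneg C])
      finally have "norm (S h) * norm (S h) \<le> (norm h * (C * D)) * norm (S h)"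
        by (simp add: power2_eq_square mult.commute mult.left_commute)
      then show ?thesis
        using False by simp
    next
      case True
      \<comment> \<open>The constants carry no sign assumption; they are nonnegative as soon as
        \<open>h\<close> is nonzero, since they bound norms.\<close>
      have "0 \<le> C * norm h" "0 \<le> D * norm h"
        using order_trans[OF L2_norm_nonneg C] order_trans[OF L2_norm_nonneg D] by auto
      then have "0 \<le> norm h * (C * D)"
        by (cases "h = 0") (simp_all add: zero_le_mult_iff)
      then show ?thesis
        by (simp add: True)
    qed
  qed
  then show ?thesis
    using S_scl by (simp add: bounded_op_def S_def)
qed

text \<open>Moving \<open>\<Psi> \<alpha>\<close> across the inner product pointwise turns the weak
  integral, tested against \<open>g\<close>, into the L2 pairing of the two analysis
  operators.\<close>

lemma
  assumes \<Psi>: "\<forall>\<alpha>\<in>space M. bounded_op scl scl0 (\<Psi> \<alpha>)"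
    and \<theta>A: "bounded_op_L2 M scl scl0 (analysis_op A)"
    and \<theta>\<Psi>: "bounded_op_L2 M scl scl0 (analysis_op \<Psi>)"
  shows has_weak_integral_frame: "has_weak_integral M ip
      (\<lambda>\<alpha>. adjoint_op ip ip0 (\<Psi> \<alpha>) (A \<alpha> h))
      (adjoint_L2 M ip ip0 (analysis_op \<Psi>) (analysis_op A h))"
    and frame_op_eq_adjoint_L2:
      "frame_op M ip ip0 A \<Psi> = adjoint_L2 M ip ip0 (analysis_op \<Psi>) \<circ> analysis_op A"
proof -
  have L2: "analysis_op A h \<in> L2 M" "analysis_op \<Psi> h \<in> L2 M" for h
    using \<theta>A \<theta>\<Psi> by (auto simp: bounded_op_L2_def)
  show *: "has_weak_integral M ip (\<lambda>\<alpha>. adjoint_op ip ip0 (\<Psi> \<alpha>) (A \<alpha> h))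
      (adjoint_L2 M ip ip0 (analysis_op \<Psi>) (analysis_op A h))" for h
    unfolding has_weak_integral_def
  proof (intro allI conjI)
    fix g
    \<comment> \<open>\<open>\<Psi> \<alpha>\<close> is known to be bounded only on
      \<open>space M\<close>, which is all the integrals see.\<close>
    have eq: "ip (adjoint_op ip ip0 (\<Psi> \<alpha>) (A \<alpha> h)) g
        = ip0 (analysis_op A h \<alpha>) (analysis_op \<Psi> g \<alpha>)" if "\<alpha> \<in> space M" for \<alpha>
      by (simp add: ip_adjoint_op[OF bspec[OF \<Psi> that]] analysis_op_def)
    show "integrable M (\<lambda>\<alpha>. ip (adjoint_op ip ip0 (\<Psi> \<alpha>) (A \<alpha> h)) g)"
      using G.integrable_ip_L2[OF L2(1) L2(2)]
      by (subst Bochner_Integration.integrable_cong[OF refl eq])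
    show "ip (adjoint_L2 M ip ip0 (analysis_op \<Psi>) (analysis_op A h)) g =
        (LINT \<alpha>|M. ip (adjoint_op ip ip0 (\<Psi> \<alpha>) (A \<alpha> h)) g)"
      unfolding ip_adjoint_L2[OF \<theta>\<Psi> L2(1)] L2_ip_def
      by (intro Bochner_Integration.integral_cong) (simp_all add: eq)
  qed
  show "frame_op M ip ip0 A \<Psi> = adjoint_L2 M ip ip0 (analysis_op \<Psi>) \<circ> analysis_op A"
    unfolding frame_op_def comp_def using H.weak_integral_eq[OF *] by (intro ext)
qed

end

subsection \<open>Perturbation\<close>

text \<open>The estimate at a single vector: \<open>n\<close> is its norm, and \<open>p\<close> and
  \<open>q\<close> are the values of the two quadratic forms there.\<close>

lemma perturbed_quadratic_bounds:
  fixes p q n a b \<kappa> \<beta> \<gamma> :: real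
  assumes ab: "a > 0" "b > 0"
    and nonneg: "n \<ge> 0" "p \<ge> 0" "q \<ge> 0" "\<kappa> \<ge> 0" "\<beta> \<ge> 0" "\<gamma> \<ge> 0"
    and lt: "\<kappa> + \<gamma> / sqrt a < 1" "\<beta> < 1"
    and p: "a * n\<^sup>2 \<le> p" "p \<le> b * n\<^sup>2"
    and pert: "sqrt \<bar>p - q\<bar> \<le> \<kappa> * sqrt p + \<beta> * sqrt q + \<gamma> * n"
  shows "a * (1 - (\<kappa> + \<beta> + \<gamma> / sqrt a) / (1 + \<beta>))\<^sup>2 * n\<^sup>2 \<le> q"
    and "q \<le> b * (1 + (\<kappa> + \<beta> + \<gamma> / sqrt b) / (1 - \<beta>))\<^sup>2 * n\<^sup>2"
proof -
  have "\<bar>sqrt p - sqrt q\<bar> \<le> sqrt p + sqrt q"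
    using real_sqrt_ge_zero[OF nonneg(2)] real_sqrt_ge_zero[OF nonneg(3)] by linarith
  have "\<bar>sqrt p - sqrt q\<bar> \<le> sqrt \<bar>p - q\<bar>"
  proof (rule real_le_rsqrt)
    have "\<bar>sqrt p - sqrt q\<bar>\<^sup>2 \<le> \<bar>sqrt p - sqrt q\<bar> * (sqrt p + sqrt q)"
      unfolding power2_eq_square using \<open>\<bar>sqrt p - sqrt q\<bar> \<le> sqrt p + sqrt q\<close>
      by (intro mult_left_mono) auto
    also have "\<dots> = \<bar>(sqrt p - sqrt q) * (sqrt p + sqrt q)\<bar>"
      using nonneg by (simp add: abs_mult)
    also have "(sqrt p - sqrt q) * (sqrt p + sqrt q) = p - q"
      using nonneg by (simp add: algebra_simps)
    finally show "\<bar>sqrt p - sqrt q\<bar>\<^sup>2 \<le> \<bar>p - q\<bar>" .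
  qed
  with pert have diff: "\<bar>sqrt p - sqrt q\<bar> \<le> \<kappa> * sqrt p + \<beta> * sqrt q + \<gamma> * n"
    by linarith
  have sp: "sqrt a * n \<le> sqrt p" "sqrt p \<le> sqrt b * n"
    using real_sqrt_le_mono[OF p(1)] real_sqrt_le_mono[OF p(2)] nonneg
    by (simp_all add: real_sqrt_mult)
  \<comment> \<open>Clearing denominators gives
    \<open>(1 + \<beta>) * l = 1 - \<kappa> - \<gamma> / sqrt a\<close> and
    \<open>(1 - \<beta>) * u = 1 + \<kappa> + \<gamma> / sqrt b\<close>, the factors that the
    square-root inequality produces.\<close>
  define l where "l = 1 - (\<kappa> + \<beta> + \<gamma> / sqrt a) / (1 + \<beta>)"
  define u where "u = 1 + (\<kappa> + \<beta> + \<gamma> / sqrt b) / (1 - \<beta>)"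
  have "\<gamma> / sqrt a \<ge> 0"
    using ab nonneg by simp
  then have "\<kappa> < 1"
    using lt by linarith
  have "(1 + \<beta>) * l = 1 - \<kappa> - \<gamma> / sqrt a"
    using nonneg by (simp add: l_def right_diff_distrib)
  then have l: "(1 + \<beta>) * (sqrt a * l) = (1 - \<kappa>) * sqrt a - \<gamma>"
    using ab by (simp add: mult.left_commute[of "1 + \<beta>"]) (simp add: algebra_simps)
  have "(1 - \<beta>) * u = 1 + \<kappa> + \<gamma> / sqrt b"
    using lt by (simp add: u_def distrib_left[of _ 1])
  then have u: "(1 - \<beta>) * (sqrt b * u) = (1 + \<kappa>) * sqrt b + \<gamma>"
    using ab by (simp add: mult.left_commute[of "1 - \<beta>"]) (simp add: algebra_simps)
  \<comment> \<open>The sign allows squaring the lower estimate.\<close>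
  have "l \<ge> 0"
    using lt nonneg by (simp add: l_def)
  have "u \<ge> 0"
    using ab lt nonneg by (simp add: u_def)
  have "(1 + \<beta>) * (sqrt a * l * n) = (1 - \<kappa>) * (sqrt a * n) - \<gamma> * n"
    using arg_cong[OF l, of "\<lambda>x. x * n"] by (simp add: algebra_simps)
  also have "\<dots> \<le> (1 - \<kappa>) * sqrt p - \<gamma> * n"
    using sp(1) \<open>\<kappa> < 1\<close> by (intro diff_right_mono mult_left_mono) auto
  also have "\<dots> \<le> (1 + \<beta>) * sqrt q"
    using diff by (simp add: algebra_simps abs_le_iff)
  finally have "sqrt a * l * n \<le> sqrt q"
    using nonneg by (simp add: mult_le_cancel_left)
  then have "(sqrt a * l * n)\<^sup>2 \<le> (sqrt q)\<^sup>2"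
    using ab nonneg \<open>l \<ge> 0\<close> by (intro power_mono) auto
  then show "a * (1 - (\<kappa> + \<beta> + \<gamma> / sqrt a) / (1 + \<beta>))\<^sup>2 * n\<^sup>2 \<le> q"
    using ab nonneg by (simp add: l_def[symmetric] power_mult_distrib)
  have "(1 - \<beta>) * sqrt q \<le> (1 + \<kappa>) * sqrt p + \<gamma> * n"
    using diff by (simp add: algebra_simps abs_le_iff)
  also have "\<dots> \<le> (1 + \<kappa>) * (sqrt b * n) + \<gamma> * n"
    using sp(2) nonneg by (intro add_right_mono mult_left_mono) auto
  also have "\<dots> = (1 - \<beta>) * (sqrt b * u * n)"
    using arg_cong[OF u, of "\<lambda>x. x * n"] by (simp add: algebra_simps)
  finally have "sqrt q \<le> sqrt b * u * n"
    using lt by (simp add: mult_le_cancel_left)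
  then have "(sqrt q)\<^sup>2 \<le> (sqrt b * u * n)\<^sup>2"
    using nonneg by (intro power_mono) auto
  then show "q \<le> b * (1 + (\<kappa> + \<beta> + \<gamma> / sqrt b) / (1 - \<beta>))\<^sup>2 * n\<^sup>2"
    using ab nonneg by (simp add: u_def[symmetric] power_mult_distrib)
qed

theorem theorem5p3:
  fixes M :: "'w measure"
    and scl :: "'k::real_or_complex \<Rightarrow> 'h::banach \<Rightarrow> 'h"
    and ip :: "'h \<Rightarrow> 'h \<Rightarrow> 'k"
    and scl0 :: "'k \<Rightarrow> 'g::banach \<Rightarrow> 'g"
    and ip0 :: "'g \<Rightarrow> 'g \<Rightarrow> 'k"
    and A B \<Psi> :: "'w \<Rightarrow> 'h \<Rightarrow> 'g"
    and a b \<kappa> \<beta> \<gamma> :: real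
  assumes "hilbert_space scl ip"
    and "hilbert_space scl0 ip0"
    and "continuous_ovf M scl ip scl0 ip0 A \<Psi>"
    and "frame_bounds M ip ip0 A \<Psi> a b"
    and "continuous_bessel M scl ip scl0 ip0 B B"
    and "positive_op ip (adjoint_L2 M ip ip0 (analysis_op \<Psi>) \<circ> analysis_op B)"
    and "\<kappa> \<ge> 0" and "\<beta> \<ge> 0" and "\<gamma> \<ge> 0"
    and "max (\<kappa> + \<gamma> / sqrt a) \<beta> < 1"
    and "\<And>h. sqrt (norm (LINT \<alpha>|M. ip0 (A \<alpha> h - B \<alpha> h) (\<Psi> \<alpha> h)))
      \<le> \<kappa> * sqrt (sre (LINT \<alpha>|M. ip0 (A \<alpha> h) (\<Psi> \<alpha> h)))
        + \<beta> * sqrt (sre (LINT \<alpha>|M. ip0 (B \<alpha> h) (\<Psi> \<alpha> h)))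
        + \<gamma> * norm h"
  shows "continuous_ovf M scl ip scl0 ip0 B \<Psi> \<and>
    frame_bounds M ip ip0 B \<Psi>
      (a * (1 - (\<kappa> + \<beta> + \<gamma> / sqrt a) / (1 + \<beta>))\<^sup>2)
      (b * (1 + (\<kappa> + \<beta> + \<gamma> / sqrt b) / (1 - \<beta>))\<^sup>2)"
proof -
  interpret hilbert_space_pair scl ip scl0 ip0
    by (intro hilbert_space_pair.intro assms)
  have bessel: "continuous_bessel M scl ip scl0 ip0 A \<Psi>"
    "continuous_bessel M scl ip scl0 ip0 B B"
    using assms by (auto simp: continuous_ovf_def)
  have \<theta>: "bounded_op_L2 M scl scl0 (analysis_op A)" "bounded_op_L2 M scl scl0 (analysis_op \<Psi>)"
    "bounded_op_L2 M scl scl0 (analysis_op B)"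
    using bessel by (auto simp: continuous_bessel_def)
  have L2: "analysis_op A h \<in> L2 M" "analysis_op \<Psi> h \<in> L2 M" "analysis_op B h \<in> L2 M" for h
    using \<theta> by (auto simp: bounded_op_L2_def)
  have \<Psi>: "\<forall>\<alpha>\<in>space M. bounded_op scl scl0 (\<Psi> \<alpha>)"
    using bessel by (auto simp: continuous_bessel_def)
  define S where "S = frame_op M ip ip0 A \<Psi>"
  define T where "T = frame_op M ip ip0 B \<Psi>"
  note S_eq = frame_op_eq_adjoint_L2[OF \<Psi> \<theta>(1,2), folded S_def]
  note T_eq = frame_op_eq_adjoint_L2[OF \<Psi> \<theta>(3,2), folded T_def]
  have S: "ip (S h) h = (LINT \<alpha>|M. ip0 (A \<alpha> h) (\<Psi> \<alpha> h))" for h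
    by (simp add: S_eq ip_adjoint_L2[OF \<theta>(2) L2(1)] L2_ip_def) (simp add: analysis_op_def)
  have T: "ip (T h) h = (LINT \<alpha>|M. ip0 (B \<alpha> h) (\<Psi> \<alpha> h))" for h
    by (simp add: T_eq ip_adjoint_L2[OF \<theta>(2) L2(3)] L2_ip_def) (simp add: analysis_op_def)
  have T_pos: "positive_op ip T"
    unfolding T_eq by fact
  have T_bounded: "bounded_op scl scl T"
    unfolding T_eq by (rule bounded_op_adjoint_L2_comp[OF \<theta>(2,3)])
  have S_pos: "positive_op ip S"
    using bessel by (simp add: continuous_bessel_def S_def)
  define l where "l = a * (1 - (\<kappa> + \<beta> + \<gamma> / sqrt a) / (1 + \<beta>))\<^sup>2"
  define u where "u = b * (1 + (\<kappa> + \<beta> + \<gamma> / sqrt b) / (1 - \<beta>))\<^sup>2"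
  have ab: "a > 0" "b > 0"
    and bounds: "\<And>h. a * (norm h)\<^sup>2 \<le> sre (ip (S h) h)" "\<And>h. sre (ip (S h) h) \<le> b * (norm h)\<^sup>2"
    using assms(4) by (auto simp: frame_bounds_def S_def)
  have lt: "\<kappa> + \<gamma> / sqrt a < 1" "\<beta> < 1"
    using assms(10) by auto
  have T_bounds: "l * (norm h)\<^sup>2 \<le> sre (ip (T h) h) \<and> sre (ip (T h) h) \<le> u * (norm h)\<^sup>2" for h
  proof -
    obtain p where p: "p \<ge> 0" "ip (S h) h = of_real p"
      using S_pos unfolding positive_op_def by blast
    obtain q where q: "q \<ge> 0" "ip (T h) h = of_real q"
      using T_pos unfolding positive_op_def by blast
    interpret ip0: bounded_bilinear ip0 by (rule G.bounded_bilinear_ip)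
    have int: "integrable M (\<lambda>\<alpha>. ip0 (A \<alpha> h) (\<Psi> \<alpha> h))" "integrable M (\<lambda>\<alpha>. ip0 (B \<alpha> h) (\<Psi> \<alpha> h))"
      using G.integrable_ip_L2[OF L2(1)[of h] L2(2)[of h]]
        G.integrable_ip_L2[OF L2(3)[of h] L2(2)[of h]] by (simp_all add: analysis_op_def)
    \<comment> \<open>Both integrals are real by positivity of \<open>S\<close> and
      \<open>T\<close>, so the norm in the hypothesis becomes
      \<open>\<bar>p - q\<bar>\<close>.\<close>
    have "(LINT \<alpha>|M. ip0 (A \<alpha> h - B \<alpha> h) (\<Psi> \<alpha> h)) = of_real (p - q)"
      using int by (simp add: ip0.diff_left S[symmetric] T[symmetric] p q)
    then have "sqrt \<bar>p - q\<bar> \<le> \<kappa> * sqrt p + \<beta> * sqrt q + \<gamma> * norm h"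
      using assms(11)[of h] by (simp add: S[symmetric] T[symmetric] p q del: of_real_diff)
    from perturbed_quadratic_bounds[OF ab _ p(1) q(1) assms(7-9) lt _ _ this]
    show ?thesis
      using bounds[of h] by (simp add: p q l_def u_def)
  qed
  \<comment> \<open>Strictness makes \<open>l\<close> positive, so the lower bound is a coercivity
    estimate for \<open>T\<close>.\<close>
  have "(\<kappa> + \<beta> + \<gamma> / sqrt a) / (1 + \<beta>) < 1"
    using lt(1) assms(8) by simp
  then have "l > 0"
    unfolding l_def using ab by (intro mult_pos_pos zero_less_power) auto
  have "(\<kappa> + \<beta> + \<gamma> / sqrt b) / (1 - \<beta>) \<ge> 0"
    using ab lt assms(7-9) by simp
  then have "u > 0"
    unfolding u_def using ab by (intro mult_pos_pos zero_less_power) auto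
  have "invertible_op scl T"
    using T_bounded \<open>l > 0\<close> T_bounds by (intro H.coercive_imp_invertible[where c = l]) auto
  \<comment> \<open>The conditions on \<open>B\<close> alone come from its Bessel property, those on
    \<Psi> from the given frame, and those on \<open>T\<close> from its form as a composition with
    an adjoint and the assumed positivity.\<close>
  moreover have "continuous_bessel M scl ip scl0 ip0 B \<Psi>"
    using bessel T_bounded T_pos has_weak_integral_frame[OF \<Psi> \<theta>(3,2)]
    unfolding continuous_bessel_def T_def by blast
  ultimately show ?thesis
    using T_bounds \<open>l > 0\<close> \<open>u > 0\<close>
    unfolding continuous_ovf_def frame_bounds_def T_def l_def u_def by blast
qed

end
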